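(* Let $\{(A_n,p_n)\}_{n\in\mathbb{N}}$ be a rare-events source with support interval $C=[\check c,\hat c]$ and limit distribution $P$. Consider a canonical estimation problem whose limit function $f$ is Lipschitz on every closed interval $[a,b]$ with $0<a\le b<\infty$. Let $\tilde P_n$, $n\in\mathbb{N}$, be random probability measures on $\mathbb{R}^+$, where $\tilde P_n$ is constructed from the samples $X_{n,1},\dots,X_{n,n}$, such that for some (deterministic) sequence $K_n\to\infty$ we have $K_n\,d_{\mathrm W}(\tilde P_n,P)\to0$ almost surely as $n\to\infty$. Then one can choose a sequence $D_n\to\infty$ (with $D_n\ge1$) such that $$\hat Y_n=\int_{\mathbb{R}^+} f_{D_n}(x)\,\mathrm{d}\tilde P_n(x)$$ is a consistent estimator, i.e. $\hat Y_n\to\int_C f(x)\,\mathrm{d}P(x)$ almost surely. More precisely, $\hat Y_n$ is consistent for any sequence $D_n\to\infty$ that additionally satisfies $$\liminf_{n\to\infty}\frac{K_n}{\mathrm{Lip}(f_{D_n})}>0 .$$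
   Context: Rare-events source: a sequence $\{(A_n,p_n)\}_{n\in\mathbb{N}}$, where $A_n$ is a finite alphabet and $p_n$ a probability mass function on $A_n$, such that, with $X_n\sim p_n$, $Z_n=n\,p_n(X_n)$ and $P_n$ the distribution of $Z_n$: (i) there is an interval $C=[\check c,\hat c]$ with $0<\check c\le\hat c<\infty$ such that $\check c/n\le p_n(a)\le\hat c/n$ for all $n$ and all $a\in A_n$; (ii) there is a probability distribution $P$ with $P_n\Rightarrow P$ weakly (so $P$ is supported on $C$). Sampling: for each $n$, $X_{n,1},\dots,X_{n,n}$ are i.i.d. from $p_n$; all samples live on a common probability space. Canonical estimation problem: the problem of estimating, from $X_{n,1},\dots,X_{n,n}$ for each $n$, a sequence of real random variables $\{Y_n\}$ such that for every rare-events source $\mathbf{E}[Y_n]=\int_C f_n(x)\,\mathrm{d}P_n(x)$, where $\{f_n\}$ is a sequence of continuous real-valued functions on $(0,\infty)$ converging pointwise to a continuous function $f$ on $(0,\infty)$; $f$ is called the limit function of the problem. An estimator is a sequence $\hat Y_n$ of real-valued functions of the samples $X_{n,1},\dots,X_{n,n}$; it is consistent if $\hat Y_n\to\int_C f\,\mathrm{d}P$ almost surely. Tapered function: for a real-valued function $g$ on $(0,\infty)$ and $D\ge1$, $g_D$ is defined on $\mathbb{R}^+=[0,\infty)$ by $g_D(x)=g(D^{-1})$ for $x<D^{-1}$, $g_D(x)=g(x)$ for $x\in[D^{-1},D]$, and $g_D(x)=g(D)$ for $x>D$. $\mathrm{Lip}(g)$ is the (smallest) Lipschitz constant of $g$ on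 $\mathbb{R}^+$; a ratio $K/\mathrm{Lip}(g)$ with $\mathrm{Lip}(g)=0$ is read as $+\infty$. $d_{\mathrm W}$ is the Wasserstein distance between probability measures on $\mathbb{R}^+$: $d_{\mathrm W}(Q_1,Q_2)=\int_{\mathbb{R}^+}|F(x;Q_1)-F(x;Q_2)|\,\mathrm{d}x$, where $F(\cdot;Q)$ is the cumulative distribution function of $Q$ (equivalently, when finite and one of the measures has compact support, $\sup_h|\int h\,\mathrm{d}Q_1-\int h\,\mathrm{d}Q_2|$ over 1-Lipschitz functions $h$). *)

theory Defs
  imports "HOL-Probability.Probability"
begin

definition scaled_prob_distr :: "(nat \<Rightarrow> 'a pmf) \<Rightarrow> nat \<Rightarrow> real measure" where
  "scaled_prob_distr p n = distr (measure_pmf (p n)) borel (\<lambda>a. real n * pmf (p n) a)"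

text \<open>Sequences are indexed by \<open>n \<ge> 1\<close>: the bounds \<open>c / n\<close> are meaningless for \<open>n = 0\<close>, so the
  value of a sequence at index \<open>0\<close> is never constrained.\<close>

definition rare_events_source ::
    "(nat \<Rightarrow> 'a set) \<Rightarrow> (nat \<Rightarrow> 'a pmf) \<Rightarrow> real \<Rightarrow> real \<Rightarrow> real measure \<Rightarrow> bool" where
  "rare_events_source A p cl cu P \<longleftrightarrow>
     (\<forall>n\<ge>1. finite (A n) \<and> set_pmf (p n) \<subseteq> A n) \<and>
     0 < cl \<and> cl \<le> cu \<and>
     (\<forall>n\<ge>1. \<forall>a\<in>A n. cl / real n \<le> pmf (p n) a \<and> pmf (p n) a \<le> cu / real n) \<and>
     real_distribution P \<and>
     weak_conv_m (scaled_prob_distr p) P"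

text \<open>\<open>X n i\<close>, for \<open>1 \<le> i \<le> n\<close>, is the \<open>i\<close>-th sample of stage \<open>n\<close>. Nothing is assumed about the
  joint law of samples belonging to different stages.\<close>

definition iid_samples ::
    "'w measure \<Rightarrow> (nat \<Rightarrow> 'a set) \<Rightarrow> (nat \<Rightarrow> 'a pmf) \<Rightarrow> (nat \<Rightarrow> nat \<Rightarrow> 'w \<Rightarrow> 'a) \<Rightarrow> bool" where
  "iid_samples M A p X \<longleftrightarrow>
     prob_space M \<and>
     (\<forall>n\<ge>1. prob_space.indep_vars M (\<lambda>_. count_space UNIV) (X n) {1..n} \<and>
       (\<forall>i\<in>{1..n}. (\<forall>\<omega>\<in>space M. X n i \<omega> \<in> A n) \<and>
          distr M (count_space UNIV) (X n i) = measure_pmf (p n)))"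

definition function_of_samples ::
    "'w measure \<Rightarrow> (nat \<Rightarrow> nat \<Rightarrow> 'w \<Rightarrow> 'a) \<Rightarrow> (nat \<Rightarrow> 'w \<Rightarrow> 'b) \<Rightarrow> bool" where
  "function_of_samples M X Z \<longleftrightarrow>
     (\<exists>g. \<forall>n\<ge>1. \<forall>\<omega>\<in>space M. Z n \<omega> = g n (\<lambda>i\<in>{1..n}. X n i \<omega>))"

text \<open>The random variables to be estimated may depend on the source and on the samples, and their
  means are prescribed for every source at once. Hence \<open>Y\<close> takes the probability space, the source
  and the samples as arguments; it need not be a function of the samples alone.\<close>

definition canonical_estimation_problem ::
    "('w measure \<Rightarrow> (nat \<Rightarrow> 'a set) \<Rightarrow> (nat \<Rightarrow> 'a pmf) \<Rightarrow> (nat \<Rightarrow> nat \<Rightarrow> 'w \<Rightarrow> 'a) \<Rightarrow> nat \<Rightarrow> 'w \<Rightarrow> real)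
      \<Rightarrow> (nat \<Rightarrow> real \<Rightarrow> real) \<Rightarrow> (real \<Rightarrow> real) \<Rightarrow> bool" where
  "canonical_estimation_problem Y fs f \<longleftrightarrow>
     (\<forall>n\<ge>1. continuous_on {0<..} (fs n)) \<and>
     continuous_on {0<..} f \<and>
     (\<forall>x>0. (\<lambda>n. fs n x) \<longlonglongrightarrow> f x) \<and>
     (\<forall>M A p cl cu P X. rare_events_source A p cl cu P \<longrightarrow> iid_samples M A p X \<longrightarrow>
       (\<forall>n\<ge>1. integrable M (Y M A p X n) \<and>
          (LINT \<omega>|M. Y M A p X n \<omega>) = (LINT x:{cl..cu}|scaled_prob_distr p n. fs n x)))"

definition consistent_estimator ::
    "'w measure \<Rightarrow> (nat \<Rightarrow> nat \<Rightarrow> 'w \<Rightarrow> 'a) \<Rightarrow> real \<Rightarrow> real \<Rightarrow> real measure \<Rightarrow> (real \<Rightarrow> real)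
      \<Rightarrow> (nat \<Rightarrow> 'w \<Rightarrow> real) \<Rightarrow> bool" where
  "consistent_estimator M X cl cu P f Yhat \<longleftrightarrow>
     function_of_samples M X Yhat \<and>
     (AE \<omega> in M. (\<lambda>n. Yhat n \<omega>) \<longlonglongrightarrow> (LINT x:{cl..cu}|P. f x))"

text \<open>Probability measures on \<open>[0, \<infinity>)\<close> are represented as Borel probability measures on the real
  line that give mass \<open>1\<close> to \<open>[0, \<infinity>)\<close>.\<close>

definition random_prob_measure_nonneg :: "'w measure \<Rightarrow> ('w \<Rightarrow> real measure) \<Rightarrow> bool" where
  "random_prob_measure_nonneg M Q \<longleftrightarrow>
     Q \<in> M \<rightarrow>\<^sub>M prob_algebra borel \<and> (\<forall>\<omega>\<in>space M. measure (Q \<omega>) {0..} = 1)"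

definition tapered :: "(real \<Rightarrow> real) \<Rightarrow> real \<Rightarrow> real \<Rightarrow> real" where
  "tapered g D x = (if x < inverse D then g (inverse D) else if x \<le> D then g x else g D)"

text \<open>The value is \<open>\<infinity>\<close> if \<open>g\<close> is not Lipschitz on \<open>[0, \<infinity>)\<close>.\<close>

definition Lip :: "(real \<Rightarrow> real) \<Rightarrow> ereal" where
  "Lip g = (INF L\<in>{L. L-lipschitz_on {0..} g}. ereal L)"

definition Lip_ratio :: "real \<Rightarrow> (real \<Rightarrow> real) \<Rightarrow> ereal" where
  "Lip_ratio K g = (if Lip g = 0 then \<infinity> else ereal K / Lip g)"

definition wasserstein :: "real measure \<Rightarrow> real measure \<Rightarrow> ennreal" where
  "wasserstein Q1 Q2 = (\<integral>\<^sup>+x\<in>{0..}. ennreal \<bar>cdf Q1 x - cdf Q2 x\<bar> \<partial>lborel)"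

end

theory Submission
  imports Defs
begin

text \<open>For an \<open>L\<close>-Lipschitz function, the integrals against two distributions on \<open>[0, \<infinity>)\<close> differ by at
  most \<open>L\<close> times their Wasserstein distance. The limit \<open>P\<close> lives on \<open>[cl, cu]\<close>, where the tapered
  function agrees with \<open>f\<close> once \<open>D\<close> is large, so the error of the estimator is eventually at most
  \<open>Lip (tapered f D) * W \<le> (K / c) * W\<close>, which tends to \<open>0\<close>. A suitable \<open>D\<close> exists because it may
  grow slowly enough for the Lipschitz constants to stay below \<open>K\<close>.\<close>

section \<open>Quantile coupling and the Wasserstein bound for Lipschitz integrals\<close>

text \<open>The witness is the generalized inverse \<open>I\<close> of the cdf, known from the proof
  of Skorohod's theorem. The last clause is the Galois connection between the two: comparisons with
  a quantile turn into comparisons with a value of the cdf.\<close>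

lemma quantile_function_exists:
  assumes "real_distribution Q"
  obtains q where "q \<in> borel_measurable (restrict_space lborel {0<..<1})"
    "distr (restrict_space lborel {0<..<1}) borel q = Q"
    "\<And>u x. u \<in> {0<..<1} \<Longrightarrow> u \<le> cdf Q x \<longleftrightarrow> q u \<le> x"
proof -
  interpret cdf_distribution Q using assms by (simp add: cdf_distribution_def)
  have meas: "I \<in> borel_measurable (restrict_space lborel {0<..<1})"
    using measurable_CI
    by (simp add: measurable_cong_sets[OF sets_restrict_space_cong[OF sets_lborel] refl])
  show ?thesis
  proof (rule that[OF meas distr_I_eq_M])
    show "u \<le> cdf Q x \<longleftrightarrow> I u \<le> x" if "u \<in> {0<..<1}" for u x
      using that by (intro pseudoinverse) auto
  qed
qed

text \<open>Couple the two distributions by evaluating both quantile functions at one uniform variable: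
  the expected distance of the coupled variables is, by Fubini, the area between the two
  distribution functions.\<close>

lemma integral_lipschitz_diff_le_cdf_diff:
  fixes h :: "real \<Rightarrow> real"
  assumes Q: "real_distribution Q1" "real_distribution Q2"
    and lip: "L-lipschitz_on UNIV h"
    and bdd: "\<And>x. \<bar>h x\<bar> \<le> B"
  shows "ennreal \<bar>(\<integral>x. h x \<partial>Q1) - (\<integral>x. h x \<partial>Q2)\<bar>
    \<le> ennreal L * (\<integral>\<^sup>+x. ennreal \<bar>cdf Q1 x - cdf Q2 x\<bar> \<partial>lborel)"
proof -
  let ?O = "restrict_space lborel {0<..<1::real}"
  obtain q1 where q1 [measurable]: "q1 \<in> borel_measurable ?O" and d1: "distr ?O borel q1 = Q1"
    and q1_le: "\<And>u x. u \<in> {0<..<1} \<Longrightarrow> u \<le> cdf Q1 x \<longleftrightarrow> q1 u \<le> x"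
    using quantile_function_exists[OF Q(1)] by blast
  obtain q2 where q2 [measurable]: "q2 \<in> borel_measurable ?O" and d2: "distr ?O borel q2 = Q2"
    and q2_le: "\<And>u x. u \<in> {0<..<1} \<Longrightarrow> u \<le> cdf Q2 x \<longleftrightarrow> q2 u \<le> x"
    using quantile_function_exists[OF Q(2)] by blast
  interpret O: prob_space ?O
    by (auto simp add: emeasure_restrict_space space_restrict_space intro!: prob_spaceI)
  interpret pair_sigma_finite ?O lborel ..
  have [measurable]: "cdf Q1 \<in> borel_measurable borel" "cdf Q2 \<in> borel_measurable borel"
    using Q by (simp_all add: cdf_distribution_def cdf_distribution.measurable_C)
  have L0: "L \<ge> 0" using lip by (rule lipschitz_on_nonneg)
  have [measurable]: "h \<in> borel_measurable borel"
    using lip by (intro borel_measurable_continuous_onI lipschitz_on_continuous_on)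
  \<comment> \<open>Boundedness of \<open>h\<close> gives integrability without any moment condition
    on \<open>Q1\<close> and \<open>Q2\<close>; their Wasserstein distance may be infinite.\<close>
  have int: "integrable ?O (\<lambda>u. h (q1 u))" "integrable ?O (\<lambda>u. h (q2 u))"
    by (rule O.integrable_const_bound[of _ B]; use bdd in simp)+
  have eq: "(\<integral>x. h x \<partial>Q1) = (\<integral>u. h (q1 u) \<partial>?O)" "(\<integral>x. h x \<partial>Q2) = (\<integral>u. h (q2 u) \<partial>?O)"
    unfolding d1[symmetric] d2[symmetric] by (rule integral_distr; simp)+
  \<comment> \<open>The region between the two cdf graphs: \<open>u\<close> lies between the cdf
    values at \<open>x\<close>. By the Galois connection the slice at a fixed \<open>u\<close> is
    the interval between the two quantiles, while the slice at a fixed \<open>x\<close> lies in the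
    interval between the cdf values. Fubini compares the two ways of measuring the region.\<close>
  define D where "D = {z. (fst z \<le> cdf Q1 (snd z)) \<noteq> (fst z \<le> cdf Q2 (snd z))}"
  have quantile: "ennreal \<bar>q1 u - q2 u\<bar> = (\<integral>\<^sup>+x. indicator D (u, x) \<partial>lborel)"
    if "u \<in> {0<..<1}" for u
  proof -
    have "indicator D (u, x) = (indicator {min (q1 u) (q2 u)..<max (q1 u) (q2 u)} x :: ennreal)" for x
      using that by (auto simp: D_def q1_le q2_le indicator_def)
    then show ?thesis
      by (simp add: max_def min_def abs_if)
  qed
  have level: "(\<integral>\<^sup>+u. indicator D (u, x) \<partial>?O) \<le> ennreal \<bar>cdf Q1 x - cdf Q2 x\<bar>" for x
  proof -
    have "(\<integral>\<^sup>+u. indicator D (u, x) \<partial>?O) = (\<integral>\<^sup>+u. indicator D (u, x) * indicator {0<..<1} u \<partial>lborel)"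
      by (rule nn_integral_restrict_space) simp
    also have "\<dots> \<le> (\<integral>\<^sup>+u. indicator {min (cdf Q1 x) (cdf Q2 x)<..max (cdf Q1 x) (cdf Q2 x)} u \<partial>lborel)"
      by (rule nn_integral_mono) (auto simp: D_def indicator_def)
    also have "\<dots> = ennreal \<bar>cdf Q1 x - cdf Q2 x\<bar>"
      by (simp add: max_def min_def abs_if)
    finally show ?thesis .
  qed
  have "ennreal \<bar>(\<integral>x. h x \<partial>Q1) - (\<integral>x. h x \<partial>Q2)\<bar>
      = ennreal (norm (\<integral>u. h (q1 u) - h (q2 u) \<partial>?O))"
    using int by (simp add: eq)
  also have "\<dots> \<le> (\<integral>\<^sup>+u. ennreal (norm (h (q1 u) - h (q2 u))) \<partial>?O)"
    using int by (intro integral_norm_bound_ennreal) auto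
  also have "\<dots> \<le> (\<integral>\<^sup>+u. ennreal L * ennreal \<bar>q1 u - q2 u\<bar> \<partial>?O)"
    using lipschitz_on_normD[OF lip] L0
    by (intro nn_integral_mono) (simp flip: ennreal_mult add: ennreal_leI)
  also have "\<dots> = ennreal L * (\<integral>\<^sup>+u. ennreal \<bar>q1 u - q2 u\<bar> \<partial>?O)"
    by (rule nn_integral_cmult) measurable
  also have "(\<integral>\<^sup>+u. ennreal \<bar>q1 u - q2 u\<bar> \<partial>?O) = (\<integral>\<^sup>+u. \<integral>\<^sup>+x. indicator D (u, x) \<partial>lborel \<partial>?O)"
    by (rule nn_integral_cong) (simp add: quantile space_restrict_space)
  also have "\<dots> = (\<integral>\<^sup>+x. \<integral>\<^sup>+u. indicator D (u, x) \<partial>?O \<partial>lborel)"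
  proof (rule Fubini'[symmetric])
    have [measurable]: "fst \<in> borel_measurable (?O \<Otimes>\<^sub>M lborel)"
      by (rule measurable_compose[OF measurable_fst]) (auto intro: measurable_restrict_space1)
    show "(\<lambda>(u, x). indicator D (u, x) :: ennreal) \<in> borel_measurable (?O \<Otimes>\<^sub>M lborel)"
      unfolding case_prod_eta indicator_def D_def mem_Collect_eq by measurable
  qed
  also have "\<dots> \<le> (\<integral>\<^sup>+x. ennreal \<bar>cdf Q1 x - cdf Q2 x\<bar> \<partial>lborel)"
    by (intro nn_integral_mono level)
  finally show ?thesis by (simp add: mult_left_mono)
qed

lemma (in real_distribution) cdf_eq_0:
  assumes "measure M S = 1" "S \<in> sets borel" "S \<inter> {..x} = {}"
  shows "cdf M x = 0"
proof -
  have "measure M (S \<union> {..x}) = measure M S + measure M {..x}"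
    using assms by (intro finite_measure_Union) auto
  then have "measure M {..x} \<le> 0" using assms(1) prob_le_1[of "S \<union> {..x}"] by linarith
  then show ?thesis by (simp add: cdf_def measure_le_0_iff)
qed

text \<open>Both cdfs vanish on the negative half-line, so the cut at 0 in
  \<open>wasserstein\<close> removes nothing from the integral.\<close>

lemma wasserstein_eq_UNIV:
  assumes "real_distribution Q1" "real_distribution Q2" "measure Q1 {0..} = 1" "measure Q2 {0..} = 1"
  shows "wasserstein Q1 Q2 = (\<integral>\<^sup>+x. ennreal \<bar>cdf Q1 x - cdf Q2 x\<bar> \<partial>lborel)"
proof -
  have "cdf Q1 x = 0" "cdf Q2 x = 0" if "x < 0" for x
    using real_distribution.cdf_eq_0[OF assms(1,3), of x]
      real_distribution.cdf_eq_0[OF assms(2,4), of x] that by (simp_all add: Int_def)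
  then show ?thesis
    unfolding wasserstein_def by (intro nn_integral_cong) (auto simp: indicator_def)
qed

text \<open>Measurability is asked of \<open>g\<close> alone: the set integral sees \<open>h\<close>
  only on \<open>S\<close>, where \<open>g\<close> may replace it. This fits a limit function about
  which nothing is known outside the positive half-line.\<close>

lemma (in real_distribution) set_integral_prob_1:
  fixes h :: "real \<Rightarrow> real"
  assumes "measure M S = 1" "S \<in> sets borel" "\<And>x. x \<in> S \<Longrightarrow> g x = h x" "g \<in> borel_measurable borel"
  shows "(LINT x:S|M. h x) = (\<integral>x. g x \<partial>M)"
proof -
  have ae: "AE x in M. x \<in> S" using assms(1,2) by (intro AE_prob_1) auto
  have "(LINT x:S|M. h x) = (LINT x:S|M. g x)"
    using assms(2,3) by (intro set_lebesgue_integral_cong) auto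
  also have "\<dots> = (\<integral>x. g x \<partial>M)"
    unfolding set_lebesgue_integral_def
    using ae assms(2,4) by (intro integral_cong_AE) auto
  finally show ?thesis .
qed

lemma kantorovich_bound:
  fixes h :: "real \<Rightarrow> real"
  assumes Q: "real_distribution Q1" "real_distribution Q2" "measure Q1 {0..} = 1" "measure Q2 {0..} = 1"
    and lip: "L-lipschitz_on {0..} h"
    and bdd: "\<And>x. x \<ge> 0 \<Longrightarrow> \<bar>h x\<bar> \<le> B"
  shows "ennreal \<bar>(LINT x:{0..}|Q1. h x) - (LINT x:{0..}|Q2. h x)\<bar> \<le> ennreal L * wasserstein Q1 Q2"
proof -
  \<comment> \<open>The constant extension of \<open>h\<close> to the negative reals. It keeps the
    Lipschitz constant, because clamping at 0 is 1-Lipschitz with range in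
    \<open>{0..}\<close>.\<close>
  define g where "g x = h (max 0 x)" for x
  have "1-lipschitz_on UNIV (\<lambda>x. max 0 x :: real)"
    by (auto simp: lipschitz_on_def dist_real_def)
  from lipschitz_on_compose2[OF this, of L h] have g: "L-lipschitz_on UNIV g"
    unfolding g_def using lipschitz_on_mono[OF lip, of "range (max 0)" L] by (simp add: image_subset_iff)
  then have m: "g \<in> borel_measurable borel"
    by (intro borel_measurable_continuous_onI lipschitz_on_continuous_on)
  have "(LINT x:{0..}|Q1. h x) = (\<integral>x. g x \<partial>Q1)"
    by (rule real_distribution.set_integral_prob_1[OF Q(1,3) _ _ m]) (auto simp: g_def)
  moreover have "(LINT x:{0..}|Q2. h x) = (\<integral>x. g x \<partial>Q2)"
    by (rule real_distribution.set_integral_prob_1[OF Q(2,4) _ _ m]) (auto simp: g_def)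
  ultimately show ?thesis
    using integral_lipschitz_diff_le_cdf_diff[OF Q(1,2) g, of B] bdd
    by (simp add: wasserstein_eq_UNIV[OF Q] g_def)
qed

section \<open>Tapered functions\<close>

text \<open>Tapering is precomposition with the clamp onto \<open>[1/D, D]\<close>, a 1-Lipschitz
  map. Lipschitz constants and bounds on that interval therefore carry over to the whole
  line.\<close>

lemma tapered_altdef:
  assumes "D \<ge> 1"
  shows "tapered g D x = g (max (inverse D) (min x D))"
proof -
  have "inverse D \<le> 1" using assms by (simp add: inverse_le_1_iff)
  then show ?thesis using assms by (auto simp: tapered_def max_def min_def)
qed

lemma tapered_lipschitz:
  assumes D: "D \<ge> 1" and g: "L-lipschitz_on {inverse D..D} g"
  shows "L-lipschitz_on UNIV (tapered g D)"
proof -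
  have "inverse D \<le> 1" using assms by (simp add: inverse_le_1_iff)
  then have r: "range (\<lambda>x. max (inverse D) (min x D)) \<subseteq> {inverse D..D}" using D by auto
  have "1-lipschitz_on UNIV (\<lambda>x. max (inverse D) (min x D))"
    by (auto simp: lipschitz_on_def dist_real_def)
  from lipschitz_on_compose2[OF this lipschitz_on_subset[OF g r]] show ?thesis
    by (simp add: tapered_altdef[OF D] cong: lipschitz_on_cong)
qed

lemma tapered_bounded:
  fixes g :: "real \<Rightarrow> real"
  assumes D: "D \<ge> 1" and g: "continuous_on {inverse D..D} g"
  obtains B where "\<And>x. \<bar>tapered g D x\<bar> \<le> B"
proof -
  have "inverse D \<le> 1" using assms by (simp add: inverse_le_1_iff)
  then have r: "max (inverse D) (min x D) \<in> {inverse D..D}" for x using D by auto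
  have "bounded (g ` {inverse D..D})"
    using g by (intro compact_imp_bounded compact_continuous_image) auto
  then obtain B where "\<forall>y\<in>g ` {inverse D..D}. norm y \<le> B" by (auto simp: bounded_iff)
  with r have "\<bar>tapered g D x\<bar> \<le> B" for x
    unfolding tapered_altdef[OF D] by (metis imageI real_norm_def)
  then show ?thesis by (rule that)
qed

section \<open>The smallest Lipschitz constant and the ratio condition\<close>

lemma Lip_le: "L-lipschitz_on {0..} g \<Longrightarrow> Lip g \<le> ereal L"
  unfolding Lip_def by (rule INF_lower) simp

lemma Lip_nonneg: "0 \<le> Lip g"
  unfolding Lip_def by (rule INF_greatest) (auto dest: lipschitz_on_nonneg)

text \<open>A strict bound on the infimum produces an actual Lipschitz constant below
  \<open>a\<close>, so it need not be shown that the infimum is attained.\<close>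

lemma Lip_lessE:
  assumes "Lip g < ereal a"
  obtains L where "L-lipschitz_on {0..} g" "L < a"
  using assms unfolding Lip_def INF_less_iff by auto

lemma Lip_ratio_gtD:
  assumes "ereal c < Lip_ratio K g" "0 < c" "0 < K"
  shows "Lip g < ereal (K / c)"
proof (cases "Lip g")
  case (real l)
  then show ?thesis using assms Lip_nonneg[of g]
    by (cases "l = 0") (auto simp: Lip_ratio_def zero_ereal_def field_simps)
next
  \<comment> \<open>Division by infinity gives 0 in \<open>ereal\<close>, so the ratio cannot exceed
    \<open>c\<close>.\<close>
  case PInf
  then show ?thesis using assms by (simp add: Lip_ratio_def)
next
  case MInf
  then show ?thesis using Lip_nonneg[of g] by simp
qed

lemma Lip_ratio_ge_1:
  assumes "Lip g \<le> ereal K" "0 < K"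
  shows "1 \<le> Lip_ratio K g"
proof (cases "Lip g")
  case (real l)
  then show ?thesis using assms Lip_nonneg[of g]
    by (cases "l = 0") (auto simp: Lip_ratio_def zero_ereal_def one_ereal_def field_simps)
next
  case PInf
  then show ?thesis using assms by simp
next
  case MInf
  then show ?thesis using Lip_nonneg[of g] by simp
qed

section \<open>Support of the limit distribution\<close>

lemma real_distribution_scaled: "real_distribution (scaled_prob_distr p n)"
  unfolding scaled_prob_distr_def by (rule prob_space.real_distribution_distr[OF prob_space_measure_pmf]) simp

text \<open>Test the weak convergence with the distance to \<open>[cl, cu]\<close>, truncated at 1.\<close>

lemma rare_events_limit_support:
  assumes "rare_events_source A p cl cu P"
  shows "measure P {cl..cu} = 1"
proof -
  from assms have fin: "\<And>n. n \<ge> 1 \<Longrightarrow> set_pmf (p n) \<subseteq> A n" and c: "0 < cl" "cl \<le> cu"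
    and bds: "\<And>n a. n \<ge> 1 \<Longrightarrow> a \<in> A n \<Longrightarrow> cl / real n \<le> pmf (p n) a \<and> pmf (p n) a \<le> cu / real n"
    and P: "real_distribution P" and conv: "weak_conv_m (scaled_prob_distr p) P"
    by (auto simp: rare_events_source_def)
  interpret P: real_distribution P by fact
  define g :: "real \<Rightarrow> real" where "g x = min 1 (max (cl - x) (max (x - cu) 0))" for x
  have g_cont: "continuous_on UNIV g" unfolding g_def by (intro continuous_intros)
  then have [measurable]: "g \<in> borel_measurable borel"
    by (rule borel_measurable_continuous_onI)
  have g01: "0 \<le> g x" "g x \<le> 1" for x by (auto simp: g_def)
  \<comment> \<open>On the support of \<open>p n\<close> the scaled masses lie in
    \<open>[cl, cu]\<close>, the zero set of \<open>g\<close>. Hence \<open>P\<close> also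
    integrates \<open>g\<close> to 0 and, as \<open>g\<close> is nonnegative, is concentrated on
    that zero set.\<close>
  have "(\<integral>x. g x \<partial>scaled_prob_distr p n) = 0" if "n \<ge> 1" for n
  proof -
    have "(\<integral>x. g x \<partial>scaled_prob_distr p n) = (\<integral>a. g (real n * pmf (p n) a) \<partial>measure_pmf (p n))"
      unfolding scaled_prob_distr_def by (subst integral_distr) auto
    also have "\<dots> = (\<integral>a. 0 \<partial>measure_pmf (p n))"
    proof (rule integral_cong_AE; simp?)
      have "g (real n * pmf (p n) a) = 0" if "a \<in> set_pmf (p n)" for a
        using bds[of n a] fin[of n] that \<open>n \<ge> 1\<close> by (auto simp: g_def field_simps)
      then show "AE a in measure_pmf (p n). g (real n * pmf (p n) a) = 0"
        by (simp add: AE_measure_pmf_iff)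
    qed
    finally show ?thesis by simp
  qed
  then have "(\<lambda>n. \<integral>x. g x \<partial>scaled_prob_distr p n) \<longlonglongrightarrow> 0"
    by (intro tendsto_eventually eventually_sequentiallyI[of 1]) auto
  moreover have "(\<lambda>n. \<integral>x. g x \<partial>scaled_prob_distr p n) \<longlonglongrightarrow> (\<integral>x. g x \<partial>P)"
    by (rule weak_conv_imp_integral_bdd_continuous_conv[OF real_distribution_scaled P conv, of g 1])
       (use g_cont g01 in \<open>auto simp: continuous_on_eq_continuous_at\<close>)
  ultimately have "(\<integral>x. g x \<partial>P) = 0" by (rule LIMSEQ_unique[symmetric])
  moreover have "integrable P g" using g01 by (intro P.integrable_const_bound[of _ 1]) auto
  ultimately have "AE x in P. g x = 0"
    using integral_nonneg_eq_0_iff_AE[of P g] g01 by auto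
  then have "AE x in P. x \<in> {cl..cu}"
    by eventually_elim (auto simp: g_def max_def min_def split: if_splits)
  then show ?thesis by (subst (asm) P.prob_eq_1[symmetric]) simp_all
qed

section \<open>Choosing a slowly growing taper level\<close>

text \<open>Take for \<open>k n\<close> the largest \<open>m\<close> up to \<open>n\<close> with
  \<open>l m\<close> below \<open>K n\<close>. Each fixed \<open>m\<close> qualifies eventually
  because \<open>K\<close> diverges, so \<open>k\<close> diverges too, however irregular
  \<open>l\<close> is.\<close>

lemma exists_slow_sequence:
  fixes K :: "nat \<Rightarrow> real" and l :: "nat \<Rightarrow> real"
  assumes "filterlim K at_top sequentially"
  obtains k :: "nat \<Rightarrow> nat" where "\<And>n. k n \<ge> 1" "filterlim k at_top sequentially"
    "eventually (\<lambda>n. l (k n) \<le> K n) sequentially"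
proof -
  \<comment> \<open>Inserting 1 keeps the set nonempty, although \<open>l 1\<close> may exceed
    \<open>K n\<close> for small \<open>n\<close>; hence the bound on \<open>l (k n)\<close> is only
    eventual.\<close>
  define S where "S n = insert 1 {m \<in> {1..n}. l m \<le> K n}" for n
  define k where "k n = Max (S n)" for n
  have fin: "finite (S n)" "S n \<noteq> {}" for n by (auto simp: S_def)
  have k_in: "k n \<in> S n" for n unfolding k_def by (rule Max_in[OF fin])
  have k1: "k n \<ge> 1" for n using k_in[of n] by (auto simp: S_def)
  have big: "eventually (\<lambda>n. l m \<le> K n) sequentially" for m
    using assms unfolding filterlim_at_top by auto
  have "eventually (\<lambda>n. m \<le> k n) sequentially" for m
    using big[of "max 1 m"] eventually_ge_at_top[of "max 1 m"]
  proof eventually_elim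
    case (elim n)
    then have "max 1 m \<in> S n" by (auto simp: S_def)
    then have "max 1 m \<le> k n" unfolding k_def using fin by (intro Max_ge)
    then show ?case by simp
  qed
  then have "filterlim k at_top sequentially" by (simp add: filterlim_at_top)
  moreover have "eventually (\<lambda>n. l (k n) \<le> K n) sequentially"
    using big[of 1]
  proof eventually_elim
    case (elim n)
    then show ?case using k_in[of n] by (auto simp: S_def)
  qed
  ultimately show ?thesis using k1 that by blast
qed

section \<open>Convergence along a single sample path\<close>

text \<open>Once \<open>[1/D, D]\<close> covers the support of \<open>P\<close>, tapering introduces
  no bias at all; only the distance between the estimated and the limit distribution is left to
  control.\<close>

lemma tapered_integral_limit:
  assumes P: "real_distribution P" "measure P {cl..cu} = 1" and c: "0 < cl" "cl \<le> cu"
    and lip: "\<And>a b. 0 < a \<Longrightarrow> a \<le> b \<Longrightarrow> \<exists>L. L-lipschitz_on {a..b} f"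
    and D: "D \<ge> 1" "inverse D \<le> cl" "cu \<le> D"
  shows "(LINT x:{0..}|P. tapered f D x) = (LINT x:{cl..cu}|P. f x)"
proof -
  interpret real_distribution P by fact
  have "inverse D \<le> 1" using D by (simp add: inverse_le_1_iff)
  then obtain L where "L-lipschitz_on {inverse D..D} f"
    using lip[of "inverse D" D] D by auto
  then have m: "tapered f D \<in> borel_measurable borel"
    using D by (intro borel_measurable_continuous_onI lipschitz_on_continuous_on tapered_lipschitz)
  have "measure P {cl..cu} \<le> measure P {0..}" using c by (intro finite_measure_mono) auto
  then have "measure P {0..} = 1" using P(2) prob_le_1[of "{0..}"] by simp
  then have "(LINT x:{0..}|P. tapered f D x) = (\<integral>x. tapered f D x \<partial>P)"
    using m by (intro set_integral_prob_1) auto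
  also have "\<dots> = (LINT x:{cl..cu}|P. f x)"
    by (rule set_integral_prob_1[OF P(2) _ _ m, symmetric]) (use D in \<open>auto simp: tapered_def\<close>)
  finally show ?thesis .
qed

text \<open>The deterministic core: \<open>Q n\<close> stands for the realization of the random
  measure at one outcome.\<close>

lemma tapered_integral_tendsto:
  assumes P: "real_distribution P" "measure P {cl..cu} = 1" and c: "0 < cl" "cl \<le> cu"
    and lip: "\<And>a b. 0 < a \<Longrightarrow> a \<le> b \<Longrightarrow> \<exists>L. L-lipschitz_on {a..b} f"
    and Q: "\<And>n. n \<ge> 1 \<Longrightarrow> real_distribution (Q n)" "\<And>n. n \<ge> 1 \<Longrightarrow> measure (Q n) {0..} = 1"
    and K: "filterlim K at_top sequentially"
    and KW: "(\<lambda>n. ereal (K n) * enn2ereal (wasserstein (Q n) P)) \<longlonglongrightarrow> 0"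
    and D: "\<forall>n\<ge>1. D n \<ge> 1" "filterlim D at_top sequentially"
    and ratio: "liminf (\<lambda>n. Lip_ratio (K n) (tapered f (D n))) > 0"
  shows "(\<lambda>n. LINT x:{0..}|Q n. tapered f (D n) x) \<longlonglongrightarrow> (LINT x:{cl..cu}|P. f x)"
proof -
  interpret P: real_distribution P by fact
  have "measure P {cl..cu} \<le> measure P {0..}" using c by (intro P.finite_measure_mono) auto
  then have P1: "measure P {0..} = 1" using P(2) P.prob_le_1[of "{0..}"] by simp
  let ?J = "LINT x:{cl..cu}|P. f x"
  let ?Y = "\<lambda>n. LINT x:{0..}|Q n. tapered f (D n) x"
  \<comment> \<open>Any real strictly between 0 and the liminf. Eventually the ratio exceeds it,
    which bounds the Lipschitz constant of the tapered function by \<open>K n / c\<close>.\<close>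
  obtain c where c': "0 < c" and evc: "eventually (\<lambda>n. ereal c < Lip_ratio (K n) (tapered f (D n))) sequentially"
  proof -
    obtain r where r: "0 < ereal r" "ereal r < liminf (\<lambda>n. Lip_ratio (K n) (tapered f (D n)))"
      using ereal_dense2[OF ratio] by auto
    then show ?thesis using less_LiminfD[OF r(2)] that[of r] by simp
  qed
  have evK: "eventually (\<lambda>n. K n > 0) sequentially"
    using K by (simp add: filterlim_at_top_dense)
  \<comment> \<open>From here on \<open>[cl, cu]\<close> lies inside the interval on which tapering
    leaves \<open>f\<close> unchanged.\<close>
  have evD: "eventually (\<lambda>n. D n \<ge> max cu (inverse cl)) sequentially"
    using D(2) unfolding filterlim_at_top by blast
  \<comment> \<open>Stated in \<open>ereal\<close> since the Wasserstein distance may be infinite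
    for some \<open>n\<close>; real convergence is recovered after the sandwich argument.\<close>
  have bound: "eventually (\<lambda>n. ereal \<bar>?Y n - ?J\<bar>
      \<le> ereal (1 / c) * (ereal (K n) * enn2ereal (wasserstein (Q n) P))) sequentially"
    using evc evK evD eventually_ge_at_top[of 1]
  proof eventually_elim
    case (elim n)
    then have Dn: "D n \<ge> 1" using D(1) by simp
    have Dcl: "inverse (D n) \<le> cl"
      using elim(3) Dn c by (simp add: field_simps)
    have "Lip (tapered f (D n)) < ereal (K n / c)"
      using elim c' by (intro Lip_ratio_gtD)
    then obtain L where L: "L-lipschitz_on {0..} (tapered f (D n))" "L < K n / c"
      by (rule Lip_lessE)
    \<comment> \<open>The constant \<open>L'\<close> only yields continuity on a compact interval,
      and thereby the bound \<open>B\<close>; the quantitative estimate uses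
      \<open>L\<close>.\<close>
    have "inverse (D n) \<le> 1" using Dn by (simp add: inverse_le_1_iff)
    then obtain L' where "L'-lipschitz_on {inverse (D n)..D n} f"
      using lip[of "inverse (D n)" "D n"] Dn by auto
    then obtain B where B: "\<And>x. \<bar>tapered f (D n) x\<bar> \<le> B"
      using tapered_bounded[OF Dn lipschitz_on_continuous_on] by blast
    have "ennreal \<bar>?Y n - ?J\<bar> \<le> ennreal L * wasserstein (Q n) P"
      using kantorovich_bound[OF Q(1) P(1) Q(2) P1 L(1) B]
        tapered_integral_limit[OF P c lip Dn Dcl] elim by simp
    also have "\<dots> \<le> ennreal (K n / c) * wasserstein (Q n) P"
      using L(2) by (intro mult_right_mono ennreal_leI) auto
    finally have "enn2ereal (ennreal \<bar>?Y n - ?J\<bar>) \<le> enn2ereal (ennreal (K n / c) * wasserstein (Q n) P)"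
      by (simp add: less_eq_ennreal.rep_eq)
    then have "ereal \<bar>?Y n - ?J\<bar> \<le> ereal (K n / c) * enn2ereal (wasserstein (Q n) P)"
      using elim c' by (simp add: times_ennreal.rep_eq)
    also have "ereal (K n / c) = ereal (1 / c) * ereal (K n)" by simp
    finally show ?case by (simp only: mult.assoc)
  qed
  have "(\<lambda>n. ereal (1 / c) * (ereal (K n) * enn2ereal (wasserstein (Q n) P))) \<longlonglongrightarrow> ereal (1/c) * 0"
    using KW by (intro tendsto_cmult_ereal) auto
  then have "(\<lambda>n. ereal \<bar>?Y n - ?J\<bar>) \<longlonglongrightarrow> 0"
    by (intro tendsto_sandwich[OF _ bound tendsto_const]) auto
  then have "(\<lambda>n. \<bar>?Y n - ?J\<bar>) \<longlonglongrightarrow> 0" by (simp add: zero_ereal_def)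
  then show ?thesis using LIM_zero_cancel tendsto_rabs_zero_iff by blast
qed

section \<open>Almost sure consistency and existence of a taper sequence\<close>

theorem lemma3:
  fixes M :: "'w measure"
    and A :: "nat \<Rightarrow> 'a set"
    and p :: "nat \<Rightarrow> 'a pmf"
    and cl cu :: real
    and P :: "real measure"
    and X :: "nat \<Rightarrow> nat \<Rightarrow> 'w \<Rightarrow> 'a"
    and Y :: "'w measure \<Rightarrow> (nat \<Rightarrow> 'a set) \<Rightarrow> (nat \<Rightarrow> 'a pmf) \<Rightarrow> (nat \<Rightarrow> nat \<Rightarrow> 'w \<Rightarrow> 'a) \<Rightarrow> nat \<Rightarrow> 'w \<Rightarrow> real"
    and fs :: "nat \<Rightarrow> real \<Rightarrow> real"
    and f :: "real \<Rightarrow> real"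
    and Pt :: "nat \<Rightarrow> 'w \<Rightarrow> real measure"
    and K :: "nat \<Rightarrow> real"
  assumes "rare_events_source A p cl cu P"
    and "iid_samples M A p X"
    and "canonical_estimation_problem Y fs f"
    and "\<And>a b. 0 < a \<Longrightarrow> a \<le> b \<Longrightarrow> \<exists>L. L-lipschitz_on {a..b} f"
    and "\<And>n. n \<ge> 1 \<Longrightarrow> random_prob_measure_nonneg M (Pt n)"
    and "function_of_samples M X Pt"
    and "filterlim K at_top sequentially"
    and "AE \<omega> in M. (\<lambda>n. ereal (K n) * enn2ereal (wasserstein (Pt n \<omega>) P)) \<longlonglongrightarrow> 0"
  shows "(\<exists>D :: nat \<Rightarrow> real. (\<forall>n\<ge>1. D n \<ge> 1) \<and> filterlim D at_top sequentially \<and>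
            liminf (\<lambda>n. Lip_ratio (K n) (tapered f (D n))) > 0 \<and>
            consistent_estimator M X cl cu P f (\<lambda>n \<omega>. LINT x:{0..}|Pt n \<omega>. tapered f (D n) x)) \<and>
         (\<forall>D :: nat \<Rightarrow> real. (\<forall>n\<ge>1. D n \<ge> 1) \<longrightarrow> filterlim D at_top sequentially \<longrightarrow>
            liminf (\<lambda>n. Lip_ratio (K n) (tapered f (D n))) > 0 \<longrightarrow>
            consistent_estimator M X cl cu P f (\<lambda>n \<omega>. LINT x:{0..}|Pt n \<omega>. tapered f (D n) x))"
proof -
  have P: "real_distribution P" "measure P {cl..cu} = 1" and c: "0 < cl" "cl \<le> cu"
    using assms(1) rare_events_limit_support[OF assms(1)] by (auto simp: rare_events_source_def)
  have Pt: "real_distribution (Pt n \<omega>)" "measure (Pt n \<omega>) {0..} = 1"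
    if "n \<ge> 1" "\<omega> \<in> space M" for n \<omega>
  proof -
    from assms(5)[OF that(1)] have "Pt n \<in> M \<rightarrow>\<^sub>M prob_algebra borel"
      and m: "measure (Pt n \<omega>) {0..} = 1"
      using that(2) by (auto simp: random_prob_measure_nonneg_def)
    then have "Pt n \<omega> \<in> space (prob_algebra borel)"
      using that(2) by (auto dest: measurable_space)
    then show "real_distribution (Pt n \<omega>)"
      by (simp add: space_prob_algebra real_distribution_def real_distribution_axioms_def)
    show "measure (Pt n \<omega>) {0..} = 1" by (rule m)
  qed
  \<comment> \<open>The claim for every admissible \<open>D\<close>, proved first because the
    existence claim then reduces to finding one admissible sequence.\<close>
  have cons: "consistent_estimator M X cl cu P f (\<lambda>n \<omega>. LINT x:{0..}|Pt n \<omega>. tapered f (D n) x)"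
    if D: "\<forall>n\<ge>1. D n \<ge> 1" "filterlim D at_top sequentially"
      "liminf (\<lambda>n. Lip_ratio (K n) (tapered f (D n))) > 0" for D :: "nat \<Rightarrow> real"
    unfolding consistent_estimator_def
  proof
    from assms(6) obtain g where
      "\<forall>n\<ge>1. \<forall>\<omega>\<in>space M. Pt n \<omega> = g n (\<lambda>i\<in>{1..n}. X n i \<omega>)"
      by (auto simp: function_of_samples_def)
    then show "function_of_samples M X (\<lambda>n \<omega>. LINT x:{0..}|Pt n \<omega>. tapered f (D n) x)"
      unfolding function_of_samples_def
      by (intro exI[of _ "\<lambda>n s. LINT x:{0..}|g n s. tapered f (D n) x"]) simp
    \<comment> \<open>The path must also lie in \<open>space M\<close>, since only there is
      \<open>Pt n\<close> known to be a distribution on the nonnegative reals.\<close>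
    show "AE \<omega> in M. (\<lambda>n. LINT x:{0..}|Pt n \<omega>. tapered f (D n) x) \<longlonglongrightarrow> (LINT x:{cl..cu}|P. f x)"
      using assms(8) AE_space
      by eventually_elim (rule tapered_integral_tendsto[OF P c assms(4) Pt assms(7) _ D])
  qed
  \<comment> \<open>Tapering at integer levels only leaves a sequence \<open>l\<close> of Lipschitz
    constants, against which the level \<open>k n\<close> can be chosen.\<close>
  have "\<exists>L. L-lipschitz_on {0..} (tapered f (real k))" if "k \<ge> 1" for k
  proof -
    have "inverse (real k) \<le> 1" using that by (simp add: inverse_le_1_iff)
    then obtain L where "L-lipschitz_on {inverse (real k)..real k} f"
      using assms(4)[of "inverse (real k)" "real k"] that by fastforce
    then show ?thesis
      using tapered_lipschitz[of "real k" L f] that by (auto intro: lipschitz_on_subset)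
  qed
  then obtain l :: "nat \<Rightarrow> real"
    where l: "\<And>k. k \<ge> 1 \<Longrightarrow> (l k)-lipschitz_on {0..} (tapered f (real k))" by metis
  obtain k :: "nat \<Rightarrow> nat" where k: "\<And>n. k n \<ge> 1" "filterlim k at_top sequentially"
    "eventually (\<lambda>n. l (k n) \<le> K n) sequentially"
    using exists_slow_sequence[OF assms(7), of l] by blast
  have "eventually (\<lambda>n. K n > 0) sequentially"
    using assms(7) by (simp add: filterlim_at_top_dense)
  \<comment> \<open>The chosen level keeps the Lipschitz constant at most \<open>K n\<close>, so the
    ratio is eventually at least 1 and the liminf is positive.\<close>
  with k(3) have "eventually (\<lambda>n. 1 \<le> Lip_ratio (K n) (tapered f (real (k n)))) sequentially"
  proof eventually_elim
    case (elim n)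
    then show ?case
      using Lip_le[OF l[OF k(1)[of n]]] by (intro Lip_ratio_ge_1) (auto intro: order_trans)
  qed
  then have "1 \<le> liminf (\<lambda>n. Lip_ratio (K n) (tapered f (real (k n))))"
    by (rule Liminf_bounded)
  then have ratio: "0 < liminf (\<lambda>n. Lip_ratio (K n) (tapered f (real (k n))))"
    by (rule less_le_trans[rotated]) simp
  have lim: "filterlim (\<lambda>n. real (k n)) at_top sequentially"
    using filterlim_compose[OF filterlim_real_sequentially k(2)] .
  have ge_1: "\<forall>n\<ge>1. real (k n) \<ge> 1" using k(1) by simp
  show ?thesis
    using ge_1 lim ratio cons[OF ge_1 lim ratio] cons
    by (intro conjI[OF exI[of _ "\<lambda>n. real (k n)"]]) simp_all
qed

end
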